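(* Let $X,Y$ be Hilbert spaces, $f:X\to[-\infty,+\infty]$ a proper function, $y_0\in Y$, and $p:X\times Y\to[-\infty,+\infty]$ a function with $p(x,y_0)=f(x)$ for all $x\in X$. Assume that for all $x\in X$ the function $p(x,\cdot)$ is $\Psi_{lsc}$-convex at $y_0$. Let $\mathcal{L}:X\times\Psi_{lsc}\to[-\infty,+\infty]$ be defined, for $\psi(y)=-a\|y\|^2+\langle v,y\rangle+c$, by $$\mathcal{L}(x,\psi)=-a\|y_0\|^2+\langle v,y_0\rangle+c-p_x^*(\psi),\qquad p_x^*(\psi)=\sup_{y\in Y}\{-a\|y\|^2+\langle v,y\rangle+c-p(x,y)\}.$$ Assume that for any $\psi\in\Psi_{lsc}$ the function $\mathcal{L}(\cdot,\psi)$ is $\Phi_{lsc}$-convex on $X$. Put $\beta=\inf_{x\in X}\sup_{\psi\in\Psi_{lsc}}\mathcal{L}(x,\psi)$. If there exist $\psi_1,\psi_2\in\Psi_{lsc}$ and $\bar x\in\operatorname{dom}f$ with $\mathcal{L}(\bar x,\psi_1)\ge\beta$ and $\mathcal{L}(\bar x,\psi_2)\ge\beta$ such that $$0\in\operatorname{co}\big(\partial_{lsc}\mathcal{L}(\cdot,\psi_1)(\bar x)\cup\partial_{lsc}\mathcal{L}(\cdot,\psi_2)(\bar x)\big),$$ then $$\inf_{x\in X} f(x)=\sup_{\psi\in\Psi_{lsc}}\inf_{x\in X}\mathcal{L}(x,\psi)=\inf_{x\in X}\sup_{\psi\in\Psi_{lsc}}\mathcal{L}(x,\psi).$$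
   Context: Hilbert spaces are real. $\operatorname{dom}f=\{x: f(x)<+\infty\}$; $f$ is proper if $\operatorname{dom}f\ne\emptyset$ and $f(x)>-\infty$ for all $x$. $\Phi_{lsc}$ is the set of all functions $\varphi:X\to\mathbb{R}$ of the form $\varphi(x)=-a\|x\|^2+\langle \ell,x\rangle+c$ with $a\ge0$, $\ell\in X^*$ (identified with $X$), $c\in\mathbb{R}$; $\Psi_{lsc}$ is the analogous set of functions $\psi(y)=-a\|y\|^2+\langle v,y\rangle+c$ on $Y$, $a\ge 0$, $v\in Y$, $c\in\mathbb{R}$. For a set $\Phi$ of real-valued functions on $X$ and $h:X\to[-\infty,+\infty]$, $\operatorname{supp}(h)=\{\varphi\in\Phi:\varphi\le h\text{ on }X\}$; $h$ is $\Phi$-convex at $x_0$ if $h(x_0)=\sup\{\varphi(x_0):\varphi\in\operatorname{supp}(h)\}$, and $\Phi$-convex on $X$ if this holds at every point ($\sup\emptyset=-\infty$). The same applies to $\Psi_{lsc}$ on $Y$. For $h:X\to[-\infty,+\infty]$ and $\bar x\in\operatorname{dom}h$, $\partial_{lsc}h(\bar x)$ is the set of all $(a,v)\in\mathbb{R}_+\times X$ (where $\mathbb{R}_+=[0,\infty)$) such that $h(x)-h(\bar x)\ge\langle v,x-\bar x\rangle-a\|x\|^2+a\|\bar x\|^2$ for all $x\in X$. $\operatorname{co}$ denotes the convex hull in $\mathbb{R}\times X$, and $0$ is the zero of $\mathbb{R}\times X$. *)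

theory Defs
  imports "HOL-Analysis.Analysis"
begin

definition edom :: "('a \<Rightarrow> ereal) \<Rightarrow> 'a set" where
  "edom f = {x. f x < \<infinity>}"

definition proper :: "('a \<Rightarrow> ereal) \<Rightarrow> bool" where
  "proper f \<longleftrightarrow> edom f \<noteq> {} \<and> (\<forall>x. f x > -\<infinity>)"

(* Continuous linear functionals are represented by vectors (Riesz).  The definition is
   polymorphic in the space, so the same constant serves as \<Phi>_lsc on X and as \<Psi>_lsc on Y. *)
definition Phi_lsc :: "('a::real_inner \<Rightarrow> real) set" where
  "Phi_lsc = {\<phi>. \<exists>a\<ge>0. \<exists>l c. \<forall>x. \<phi> x = - a * (norm x)\<^sup>2 + l \<bullet> x + c}"

abbreviation (input) Psi_lsc :: "('b::real_inner \<Rightarrow> real) set" where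
  "Psi_lsc \<equiv> Phi_lsc"

definition supp :: "('a \<Rightarrow> real) set \<Rightarrow> ('a \<Rightarrow> ereal) \<Rightarrow> ('a \<Rightarrow> real) set" where
  "supp \<Phi> h = {\<phi> \<in> \<Phi>. \<forall>x. ereal (\<phi> x) \<le> h x}"

definition abs_convex_at :: "('a \<Rightarrow> real) set \<Rightarrow> ('a \<Rightarrow> ereal) \<Rightarrow> 'a \<Rightarrow> bool" where
  "abs_convex_at \<Phi> h x0 \<longleftrightarrow> h x0 = (SUP \<phi>\<in>supp \<Phi> h. ereal (\<phi> x0))"

definition abs_convex :: "('a \<Rightarrow> real) set \<Rightarrow> ('a \<Rightarrow> ereal) \<Rightarrow> bool" where
  "abs_convex \<Phi> h \<longleftrightarrow> (\<forall>x. abs_convex_at \<Phi> h x)"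

(* Only meaningful for points of the domain of h; taken to be empty elsewhere.
   If h xb = -\<infinity>, every h x - h xb is \<infinity> in ereal (also when h x = -\<infinity>), so the
   inequality then holds trivially. *)
definition subdiff_lsc :: "('a::real_inner \<Rightarrow> ereal) \<Rightarrow> 'a \<Rightarrow> (real \<times> 'a) set" where
  "subdiff_lsc h xb = {(a, v). xb \<in> edom h \<and> a \<ge> 0 \<and>
     (\<forall>x. h x - h xb \<ge> ereal (v \<bullet> (x - xb) - a * (norm x)\<^sup>2 + a * (norm xb)\<^sup>2))}"

definition conjugate :: "('b \<Rightarrow> ereal) \<Rightarrow> ('b \<Rightarrow> real) \<Rightarrow> ereal" where
  "conjugate g \<psi> = (SUP y. ereal (\<psi> y) - g y)"

definition Lagrangian :: "('a \<Rightarrow> 'b \<Rightarrow> ereal) \<Rightarrow> 'b \<Rightarrow> 'a \<Rightarrow> ('b \<Rightarrow> real) \<Rightarrow> ereal" where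
  "Lagrangian p y0 x \<psi> = ereal (\<psi> y0) - conjugate (p x) \<psi>"

end

theory Submission
  imports Defs
begin

text \<open>Let \<open>\<beta>\<close> be finite and let \<open>C\<close> be the set of all \<open>(a, v)\<close> for which some \<open>\<psi>\<close> satisfies
  \<open>L(x, \<psi>) \<ge> \<beta> + \<langle>v, x - xb\<rangle> - a \<parallel>x\<parallel>\<^sup>2 + a \<parallel>xb\<parallel>\<^sup>2\<close> for every \<open>x\<close>.  Since \<open>L(x, \<cdot>)\<close> is concave,
  \<open>C\<close> is convex; it contains both subdifferentials because \<open>L(xb, \<psi>\<^sub>i) \<ge> \<beta>\<close>.  Hence \<open>0 \<in> C\<close>, which
  gives a single \<open>\<psi>\<close> with \<open>inf L(\<cdot>, \<psi>) \<ge> \<beta>\<close>.  Convexity of \<open>p x\<close> at \<open>y0\<close> identifies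
  \<open>sup L(x, \<cdot>)\<close> with \<open>f x\<close>.\<close>

lemma Phi_lsc_convex_combination:
  assumes "\<phi>1 \<in> Phi_lsc" "\<phi>2 \<in> Phi_lsc" and st: "s \<ge> 0" "t \<ge> 0"
  shows "(\<lambda>x. s * \<phi>1 x + t * \<phi>2 x) \<in> Phi_lsc"
proof -
  obtain a1 l1 c1 where 1: "a1 \<ge> 0" "\<And>x. \<phi>1 x = - a1 * (norm x)\<^sup>2 + l1 \<bullet> x + c1"
    using assms(1) unfolding Phi_lsc_def by blast
  obtain a2 l2 c2 where 2: "a2 \<ge> 0" "\<And>x. \<phi>2 x = - a2 * (norm x)\<^sup>2 + l2 \<bullet> x + c2"
    using assms(2) unfolding Phi_lsc_def by blast
  have "s * \<phi>1 x + t * \<phi>2 x =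
      - (s * a1 + t * a2) * (norm x)\<^sup>2 + (s *\<^sub>R l1 + t *\<^sub>R l2) \<bullet> x + (s * c1 + t * c2)" for x
    unfolding 1(2) 2(2) by (simp add: inner_add_left algebra_simps)
  moreover have "s * a1 + t * a2 \<ge> 0"
    using 1(1) 2(1) st by simp
  ultimately show ?thesis
    unfolding Phi_lsc_def by blast
qed

text \<open>The Lagrangian is the infimum over \<open>y\<close> of
  \<open>p x y - \<psi> y + \<psi> y0\<close>, so a lower bound can be tested pointwise in
  \<open>y\<close>. With a real \<open>r\<close> no ambiguous difference of infinities
  arises.\<close>

lemma le_Lagrangian_iff:
  "ereal r \<le> Lagrangian p y0 x \<psi> \<longleftrightarrow> (\<forall>y. ereal (r + \<psi> y - \<psi> y0) \<le> p x y)"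
proof -
  have "ereal r \<le> Lagrangian p y0 x \<psi> \<longleftrightarrow> conjugate (p x) \<psi> \<le> ereal (\<psi> y0 - r)"
    unfolding Lagrangian_def by (cases "conjugate (p x) \<psi>") auto
  also have "\<dots> \<longleftrightarrow> (\<forall>y. ereal (\<psi> y) - p x y \<le> ereal (\<psi> y0 - r))"
    unfolding conjugate_def by (simp add: SUP_le_iff)
  also have "\<dots> \<longleftrightarrow> (\<forall>y. ereal (r + \<psi> y - \<psi> y0) \<le> p x y)"
  proof (rule all_cong1)
    show "ereal (\<psi> y) - p x y \<le> ereal (\<psi> y0 - r) \<longleftrightarrow> ereal (r + \<psi> y - \<psi> y0) \<le> p x y" for y
      by (cases "p x y") auto
  qed
  finally show ?thesis .
qed

text \<open>At each \<open>y\<close> both hypotheses bound the same number \<open>p x y\<close> from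
  below, and an average of two lower bounds is again a lower bound.\<close>

lemma Lagrangian_concave:
  assumes "ereal r1 \<le> Lagrangian p y0 x \<psi>1" "ereal r2 \<le> Lagrangian p y0 x \<psi>2"
    and "s \<ge> 0" "t \<ge> 0" "s + t = 1"
  shows "ereal (s * r1 + t * r2) \<le> Lagrangian p y0 x (\<lambda>y. s * \<psi>1 y + t * \<psi>2 y)"
  unfolding le_Lagrangian_iff
proof
  fix y
  let ?q1 = "r1 + \<psi>1 y - \<psi>1 y0" and ?q2 = "r2 + \<psi>2 y - \<psi>2 y0"
  \<comment> \<open>Passing through the maximum keeps the averaging in the reals, as
    \<open>p x y\<close> may be infinite.\<close>
  have "s * ?q1 + t * ?q2 \<le> max ?q1 ?q2"
    by (rule convex_bound_le) (use assms in auto)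
  moreover have "ereal (max ?q1 ?q2) \<le> p x y"
    using assms(1,2) by (auto simp: le_Lagrangian_iff max_def)
  moreover have "s * r1 + t * r2 + (s * \<psi>1 y + t * \<psi>2 y) - (s * \<psi>1 y0 + t * \<psi>2 y0)
      = s * ?q1 + t * ?q2"
    by (simp add: algebra_simps)
  ultimately show "ereal (s * r1 + t * r2 + (s * \<psi>1 y + t * \<psi>2 y) - (s * \<psi>1 y0 + t * \<psi>2 y0)) \<le> p x y"
    by (metis ereal_less_eq(3) order_trans)
qed

lemma Lagrangian_le: "Lagrangian p y0 x \<psi> \<le> p x y0"
proof -
  have "ereal (\<psi> y0) - p x y0 \<le> conjugate (p x) \<psi>"
    unfolding conjugate_def by (rule SUP_upper) simp
  then show ?thesis
    unfolding Lagrangian_def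
    by (cases "p x y0"; cases "conjugate (p x) \<psi>") auto
qed

lemma SUP_Lagrangian:
  assumes "abs_convex_at Psi_lsc (p x) y0"
  shows "(SUP \<psi>\<in>Psi_lsc. Lagrangian p y0 x \<psi>) = p x y0"
proof (rule antisym)
  show "(SUP \<psi>\<in>Psi_lsc. Lagrangian p y0 x \<psi>) \<le> p x y0"
    by (rule SUP_least) (rule Lagrangian_le)
  \<comment> \<open>For \<open>r = \<psi> y0\<close> the pointwise criterion reduces to
    \<open>\<psi> y \<le> p x y\<close>, which is membership in the support.\<close>
  have "ereal (\<psi> y0) \<le> Lagrangian p y0 x \<psi>" if "\<psi> \<in> supp Psi_lsc (p x)" for \<psi>
    using that by (simp add: le_Lagrangian_iff supp_def)
  then have "(SUP \<psi>\<in>supp Psi_lsc (p x). ereal (\<psi> y0)) \<le> (SUP \<psi>\<in>Psi_lsc. Lagrangian p y0 x \<psi>)"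
    by (intro SUP_mono) (auto simp: supp_def)
  then show "p x y0 \<le> (SUP \<psi>\<in>Psi_lsc. Lagrangian p y0 x \<psi>)"
    using assms by (simp add: abs_convex_at_def)
qed

text \<open>Membership gives \<open>h xb < \<infinity>\<close> and \<open>b\<close> bounds
  \<open>h xb\<close> from below, so \<open>h xb\<close> is finite and can be moved across the
  subgradient inequality.\<close>

lemma subdiff_lsc_minorant:
  assumes "(a, v) \<in> subdiff_lsc h xb" "ereal b \<le> h xb"
  shows "ereal (b + (v \<bullet> (x - xb) - a * (norm x)\<^sup>2 + a * (norm xb)\<^sup>2)) \<le> h x"
proof -
  let ?q = "v \<bullet> (x - xb) - a * (norm x)\<^sup>2 + a * (norm xb)\<^sup>2"
  have "h xb < \<infinity>" "ereal ?q \<le> h x - h xb"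
    using assms(1) by (auto simp: subdiff_lsc_def edom_def)
  with assms(2) show ?thesis
    by (cases "h xb"; cases "h x") auto
qed

text \<open>This is the set \<open>C\<close> of the overview. All multipliers share the level
  \<open>b\<close> instead of their own values at \<open>xb\<close>, so members belonging to
  different multipliers can be averaged.\<close>

definition minorant_slopes ::
  "('a::real_inner \<Rightarrow> 'b::real_inner \<Rightarrow> ereal) \<Rightarrow> 'b \<Rightarrow> 'a \<Rightarrow> real \<Rightarrow> (real \<times> 'a) set"
  where "minorant_slopes p y0 xb b = {(a, v). \<exists>\<psi>\<in>Psi_lsc. \<forall>x.
    ereal (b + (v \<bullet> (x - xb) - a * (norm x)\<^sup>2 + a * (norm xb)\<^sup>2)) \<le> Lagrangian p y0 x \<psi>}"

lemma convex_minorant_slopes: "convex (minorant_slopes p y0 xb b)"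
proof (rule convexI)
  fix z1 z2 and s t :: real
  assume z: "z1 \<in> minorant_slopes p y0 xb b" "z2 \<in> minorant_slopes p y0 xb b"
    and st: "s \<ge> 0" "t \<ge> 0" "s + t = 1"
  obtain a1 v1 a2 v2 where zeq: "z1 = (a1, v1)" "z2 = (a2, v2)"
    by (cases z1, cases z2)
  define q where "q a v x = b + (v \<bullet> (x - xb) - a * (norm x)\<^sup>2 + a * (norm xb)\<^sup>2)" for a v x
  obtain \<psi>1 where 1: "\<psi>1 \<in> Psi_lsc" "\<And>x. ereal (q a1 v1 x) \<le> Lagrangian p y0 x \<psi>1"
    using z(1) unfolding zeq minorant_slopes_def q_def by blast
  obtain \<psi>2 where 2: "\<psi>2 \<in> Psi_lsc" "\<And>x. ereal (q a2 v2 x) \<le> Lagrangian p y0 x \<psi>2"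
    using z(2) unfolding zeq minorant_slopes_def q_def by blast
  have "q (s * a1 + t * a2) (s *\<^sub>R v1 + t *\<^sub>R v2) x = s * q a1 v1 x + t * q a2 v2 x" for x
  proof -
    \<comment> \<open>Apart from the constant \<open>b\<close>, the minorant is linear in
      \<open>(a, v)\<close>; the constant splits because the weights sum to 1.\<close>
    have "b = s * b + t * b"
      using st(3) by (simp flip: distrib_right)
    then show ?thesis
      unfolding q_def by (simp add: inner_add_left algebra_simps)
  qed
  then have "ereal (q (s * a1 + t * a2) (s *\<^sub>R v1 + t *\<^sub>R v2) x)
      \<le> Lagrangian p y0 x (\<lambda>y. s * \<psi>1 y + t * \<psi>2 y)" for x
    using Lagrangian_concave[OF 1(2) 2(2) st] by simp
  moreover have "(\<lambda>y. s * \<psi>1 y + t * \<psi>2 y) \<in> Psi_lsc"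
    using 1(1) 2(1) st by (intro Phi_lsc_convex_combination)
  ultimately show "s *\<^sub>R z1 + t *\<^sub>R z2 \<in> minorant_slopes p y0 xb b"
    unfolding zeq minorant_slopes_def q_def by auto
qed

lemma subdiff_lsc_subset_minorant_slopes:
  assumes "\<psi> \<in> Psi_lsc" "ereal b \<le> Lagrangian p y0 xb \<psi>"
  shows "subdiff_lsc (\<lambda>x. Lagrangian p y0 x \<psi>) xb \<subseteq> minorant_slopes p y0 xb b"
  using subdiff_lsc_minorant[where h = "\<lambda>x. Lagrangian p y0 x \<psi>"] assms
  unfolding minorant_slopes_def by blast

theorem theorem7:
  fixes f :: "'a::{real_inner, complete_space} \<Rightarrow> ereal"
    and p :: "'a \<Rightarrow> 'b::{real_inner, complete_space} \<Rightarrow> ereal"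
    and y0 :: 'b
    and \<beta> :: ereal
    and \<psi>1 \<psi>2 :: "'b \<Rightarrow> real"
    and xb :: 'a
  assumes "proper f"
    and "\<And>x. p x y0 = f x"
    and "\<And>x. abs_convex_at Psi_lsc (p x) y0"
    and "\<And>\<psi>. \<psi> \<in> Psi_lsc \<Longrightarrow> abs_convex Phi_lsc (\<lambda>x. Lagrangian p y0 x \<psi>)"
    and "\<beta> = (INF x. SUP \<psi>\<in>Psi_lsc. Lagrangian p y0 x \<psi>)"
    and "\<psi>1 \<in> Psi_lsc" and "\<psi>2 \<in> Psi_lsc" and "xb \<in> edom f"
    and "Lagrangian p y0 xb \<psi>1 \<ge> \<beta>" and "Lagrangian p y0 xb \<psi>2 \<ge> \<beta>"
    and "0 \<in> convex hull (subdiff_lsc (\<lambda>x. Lagrangian p y0 x \<psi>1) xb \<union>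
                          subdiff_lsc (\<lambda>x. Lagrangian p y0 x \<psi>2) xb)"
  shows "(INF x. f x) = (SUP \<psi>\<in>Psi_lsc. INF x. Lagrangian p y0 x \<psi>) \<and>
         (SUP \<psi>\<in>Psi_lsc. INF x. Lagrangian p y0 x \<psi>) = (INF x. SUP \<psi>\<in>Psi_lsc. Lagrangian p y0 x \<psi>)"
proof -
  let ?L = "Lagrangian p y0"
  have sup: "(SUP \<psi>\<in>Psi_lsc. ?L x \<psi>) = f x" for x
    using SUP_Lagrangian[OF assms(3)] assms(2) by simp
  have \<beta>: "\<beta> = (INF x. f x)"
    using assms(5) by (simp add: sup)
  have weak: "(SUP \<psi>\<in>Psi_lsc. INF x. ?L x \<psi>) \<le> \<beta>"
    unfolding assms(5) by (rule SUP_least, rule INF_greatest) (meson INF_lower2 SUP_upper UNIV_I)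
  \<comment> \<open>The case \<open>-\<infinity>\<close> is trivial below, so this leaves only a
    finite \<open>\<beta>\<close>, which can serve as the real level \<open>b\<close>.\<close>
  have "\<beta> < \<infinity>"
  proof -
    have "\<beta> \<le> f xb"
      unfolding \<beta> by (rule INF_lower) simp
    then show ?thesis
      using assms(8) by (auto simp: edom_def)
  qed
  have "\<beta> \<le> (SUP \<psi>\<in>Psi_lsc. INF x. ?L x \<psi>)"
  proof (cases \<beta>)
    case (real b)
    have "subdiff_lsc (\<lambda>x. ?L x \<psi>1) xb \<union> subdiff_lsc (\<lambda>x. ?L x \<psi>2) xb \<subseteq> minorant_slopes p y0 xb b"
      using assms(6,7,9,10) real by (simp add: subdiff_lsc_subset_minorant_slopes)
    then have "0 \<in> minorant_slopes p y0 xb b"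
      using hull_minimal[where S = convex] convex_minorant_slopes assms(11) by blast
    \<comment> \<open>At slope zero the quadratic minorant collapses to the constant
      \<open>b\<close>.\<close>
    then obtain \<psi> where "\<psi> \<in> Psi_lsc" "\<And>x. \<beta> \<le> ?L x \<psi>"
      unfolding minorant_slopes_def real by (auto simp: zero_prod_def)
    then show ?thesis
      by (auto intro: SUP_upper2 INF_greatest)
  qed (use \<open>\<beta> < \<infinity>\<close> in auto)
  with weak show ?thesis
    using \<beta> assms(5) by auto
qed

end
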